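(* Let $\mathbb{F}_q$ be a finite field with $q$ elements, let $a, b \in \mathbb{Z}$, and suppose that $\Delta_E = -16(4a^3 + 27b^2)$ is non-zero in $\mathbb{F}_q$. Suppose that $g(X) = X^3 + aX + b$ has three distinct roots in $\mathbb{F}_q$. Let $E(\mathbb{F}_q)$ be the group of $\mathbb{F}_q$-points of the elliptic curve defined by the Weierstrass equation $Y^2 = g(X)$. Then $E(\mathbb{F}_q)$ admits a (continuous) inverse ambiguous function.
   Context: For a group $G$, a function $f : G \to G$ is called inverse ambiguous if it is bijective and its inverse function satisfies $f^{-1}(x) = (f(x))^{-1}$ for all $x \in G$, where the right-hand side is the group inverse of $f(x)$. Equivalently, $f(f(x)) = x^{-1}$ for all $x \in G$ (written additively on an elliptic curve: $f(f(P)) = -P$). The group $E(\mathbb{F}_q)$ consists of the solutions $(x,y) \in \mathbb{F}_q^2$ of the Weierstrass equation (with coefficients reduced into $\mathbb{F}_q$) together with the point at infinity $O$, which is the identity of the usual elliptic curve group law. It is finite and is given the discrete topology, so continuity is automatic. *)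

theory Defs
  imports
    "HOL-Algebra.Group"
    "HOL-Analysis.Abstract_Topology"
    "HOL-Computational_Algebra.Polynomial"
begin

definition inverse_ambiguous :: "('g, 'm) monoid_scheme \<Rightarrow> ('g \<Rightarrow> 'g) \<Rightarrow> bool" where
  "inverse_ambiguous G f \<longleftrightarrow>
     bij_betw f (carrier G) (carrier G) \<and>
     (\<forall>x\<in>carrier G. inv_into (carrier G) f x = inv\<^bsub>G\<^esub> (f x))"

definition weierstrass_poly :: "'a::field \<Rightarrow> 'a \<Rightarrow> 'a poly" where
  "weierstrass_poly a b = [:b, a, 0, 1:]"

datatype 'a point = Infinity | Point 'a 'a

text \<open>
  The chord-and-tangent law on \<open>Y\<^sup>2 = X\<^sup>3 + a X + b\<close>. On the curve, \<open>x1 = x2\<close> forces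
  \<open>y2 = y1\<close> or \<open>y2 = - y1\<close>; so in characteristic other than 2 the tangent slope is only used
  for doubling a point with \<open>y1 \<noteq> 0\<close>. Off the curve, and in characteristic 2 (where such a
  curve is singular), the values are meaningless.
\<close>

fun ec_add :: "'a::field \<Rightarrow> 'a point \<Rightarrow> 'a point \<Rightarrow> 'a point" where
  "ec_add a Infinity Q = Q"
| "ec_add a P Infinity = P"
| "ec_add a (Point x1 y1) (Point x2 y2) =
     (if x1 = x2 \<and> y1 = - y2 then Infinity
      else let l = (if x1 = x2 then (3 * x1\<^sup>2 + a) / (2 * y1) else (y2 - y1) / (x2 - x1));
               x3 = l\<^sup>2 - x1 - x2
           in Point x3 (l * (x1 - x3) - y1))"

definition elliptic_curve :: "'a::field \<Rightarrow> 'a \<Rightarrow> 'a point monoid" where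
  "elliptic_curve a b =
     \<lparr>carrier = insert Infinity {Point x y | x y. y\<^sup>2 = poly (weierstrass_poly a b) x},
      monoid.mult = ec_add a,
      one = Infinity\<rparr>"

lemma point_in_elliptic_curve_iff:
  "Point x y \<in> carrier (elliptic_curve a b) \<longleftrightarrow> y\<^sup>2 = x ^ 3 + a * x + b"
  by (auto simp: elliptic_curve_def weierstrass_poly_def algebra_simps power3_eq_cube)

lemma ec_add_eq_Infinity_iff:
  "ec_add a (Point x y) Q = Infinity \<longleftrightarrow> Q = Point x (- y)"
  by (cases Q) (auto simp: Let_def)

lemma inv_elliptic_curve_Infinity: "inv\<^bsub>elliptic_curve a b\<^esub> Infinity = Infinity"
  unfolding m_inv_def by (rule the_equality) (auto simp: elliptic_curve_def)

lemma inv_elliptic_curve_Point: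
  assumes "Point x y \<in> carrier (elliptic_curve a b)"
  shows "inv\<^bsub>elliptic_curve a b\<^esub> (Point x y) = Point x (- y)"
  unfolding m_inv_def
proof (rule the_equality)
  show "Point x (- y) \<in> carrier (elliptic_curve a b) \<and>
      Point x y \<otimes>\<^bsub>elliptic_curve a b\<^esub> Point x (- y) = \<one>\<^bsub>elliptic_curve a b\<^esub> \<and>
      Point x (- y) \<otimes>\<^bsub>elliptic_curve a b\<^esub> Point x y = \<one>\<^bsub>elliptic_curve a b\<^esub>"
    using assms by (auto simp: elliptic_curve_def)
  fix Q
  assume "Q \<in> carrier (elliptic_curve a b) \<and>
      Point x y \<otimes>\<^bsub>elliptic_curve a b\<^esub> Q = \<one>\<^bsub>elliptic_curve a b\<^esub> \<and>
      Q \<otimes>\<^bsub>elliptic_curve a b\<^esub> Point x y = \<one>\<^bsub>elliptic_curve a b\<^esub>"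
  then show "Q = Point x (- y)"
    using ec_add_eq_Infinity_iff[of a x y Q] by (simp add: elliptic_curve_def)
qed

lemma ec_add_closed:
  fixes a b :: "'a::field"
  assumes "(2::'a) \<noteq> 0"
    and "P \<in> carrier (elliptic_curve a b)" "Q \<in> carrier (elliptic_curve a b)"
  shows "ec_add a P Q \<in> carrier (elliptic_curve a b)"
proof (cases P)
  case Infinity
  then show ?thesis using assms by simp
next
  case P: (Point x1 y1)
  show ?thesis
  proof (cases Q)
    case Infinity
    then show ?thesis using assms P by simp
  next
    case Q: (Point x2 y2)
    have e1: "y1\<^sup>2 = x1 ^ 3 + a * x1 + b" and e2: "y2\<^sup>2 = x2 ^ 3 + a * x2 + b"
      using assms P Q by (simp_all add: point_in_elliptic_curve_iff)
    have inf: "Infinity \<in> carrier (elliptic_curve a b)"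
      by (simp add: elliptic_curve_def)
    show ?thesis
    proof (cases "x1 = x2")
      case False
      define l where "l = (y2 - y1) / (x2 - x1)"
      have l: "l * (x2 - x1) = y2 - y1"
        using False by (simp add: l_def)
      have "(x2 - x1) * ((l * (x1 - (l\<^sup>2 - x1 - x2)) - y1)\<^sup>2 -
          ((l\<^sup>2 - x1 - x2) ^ 3 + a * (l\<^sup>2 - x1 - x2) + b)) = 0"
        using l e1 e2 by algebra
      then have "(l * (x1 - (l\<^sup>2 - x1 - x2)) - y1)\<^sup>2 =
          (l\<^sup>2 - x1 - x2) ^ 3 + a * (l\<^sup>2 - x1 - x2) + b"
        using False by simp
      then show ?thesis
        using False P Q by (simp add: Let_def point_in_elliptic_curve_iff flip: l_def)
    next
      case True
      show ?thesis
      proof (cases "y1 = - y2")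
        case True
        then show ?thesis using \<open>x1 = x2\<close> P Q inf by simp
      next
        case False
        have "(y1 - y2) * (y1 + y2) = 0"
          using e1 e2 True by algebra
        then have y: "y2 = y1"
          using False by (simp add: add_eq_0_iff2)
        then have "2 * y1 \<noteq> 0"
          using False assms by auto
        define l where "l = (3 * x1\<^sup>2 + a) / (2 * y1)"
        have l: "l * (2 * y1) = 3 * x1\<^sup>2 + a"
          using \<open>2 * y1 \<noteq> 0\<close> by (simp add: l_def)
        have "(l * (x1 - (l\<^sup>2 - x1 - x1)) - y1)\<^sup>2 =
            (l\<^sup>2 - x1 - x1) ^ 3 + a * (l\<^sup>2 - x1 - x1) + b"
          using l e1 by algebra
        moreover have "ec_add a P Q = Point (l\<^sup>2 - x1 - x1) (l * (x1 - (l\<^sup>2 - x1 - x1)) - y1)"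
          using False True y P Q by (simp add: Let_def l_def)
        ultimately show ?thesis
          by (simp only: point_in_elliptic_curve_iff)
      qed
    qed
  qed
qed

end

theory Submission imports Defs begin

text \<open>
  A map \<open>f\<close> with \<open>f (f P) = - P\<close> consists of 4-cycles \<open>P, f P, - P, - f P\<close> outside the points fixed by
  negation, so it exists as soon as the pairs \<open>{P, - P}\<close> with \<open>P \<noteq> - P\<close>, that is, the abscissae \<open>x\<close>
  where \<open>g x\<close> is a nonzero square, can themselves be matched in pairs. Translation by the 2-torsion
  point \<open>(e, 0)\<close> acts on these abscissae by \<open>e + z \<mapsto> e + u v / z\<close>, where \<open>g (e + z) = z (z + u) (z + v)\<close>.
  This involution fixes \<open>e + z\<close> only if \<open>z\<^sup>2 = u v\<close>, and then
  \<open>g (e + z) g (e - z) = (z\<^sup>2 (u - v))\<^sup>2\<close>, so \<open>e + z\<close> can be matched with \<open>e - z\<close>. Working with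
  abscissae avoids both the associativity of the group law and Lagrange's theorem.
\<close>

lemma inverse_ambiguousI:
  assumes closed: "\<And>x. x \<in> carrier G \<Longrightarrow> f x \<in> carrier G"
    and square: "\<And>x. x \<in> carrier G \<Longrightarrow> f (f x) = inv\<^bsub>G\<^esub> x"
    and inv_closed: "\<And>x. x \<in> carrier G \<Longrightarrow> inv\<^bsub>G\<^esub> x \<in> carrier G"
    and inv_inv: "\<And>x. x \<in> carrier G \<Longrightarrow> inv\<^bsub>G\<^esub> (inv\<^bsub>G\<^esub> x) = x"
  shows "inverse_ambiguous G f"
proof -
  \<comment> \<open>On the carrier the fourth iterate of \<open>f\<close> is the identity, and the
    inverse of \<open>f x\<close> is the third iterate at \<open>x\<close>.\<close>
  have f_inv: "f (inv\<^bsub>G\<^esub> (f x)) = x" if "x \<in> carrier G" for x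
    using that by (metis closed square inv_inv)
  have inj: "inj_on f (carrier G)"
    by (rule inj_onI) (metis square inv_inv)
  have "f ` carrier G = carrier G"
  proof (intro equalityI subsetI)
    fix x assume "x \<in> carrier G"
    then show "x \<in> f ` carrier G"
      using f_inv[of x] closed[of x] inv_closed[of "f x"] by (metis imageI)
  qed (use closed in blast)
  moreover have "inv_into (carrier G) f x = inv\<^bsub>G\<^esub> (f x)" if "x \<in> carrier G" for x
    using inv_into_f_f[OF inj, of "inv\<^bsub>G\<^esub> (f x)"] f_inv closed inv_closed that by simp
  ultimately show ?thesis
    using inj by (simp add: inverse_ambiguous_def bij_betw_def)
qed

lemma inverse_ambiguous_elliptic_curve_if_matching:
  fixes a b :: "'a::{field, finite}"
  assumes two: "(2::'a) \<noteq> 0"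
    and S_def: "S = {x. \<exists>y. y \<noteq> 0 \<and> y\<^sup>2 = x ^ 3 + a * x + b}"
    and t_closed: "\<And>x. x \<in> S \<Longrightarrow> t x \<in> S"
    and t_t: "\<And>x. x \<in> S \<Longrightarrow> t (t x) = x"
    and t_neq: "\<And>x. x \<in> S \<Longrightarrow> t x \<noteq> x"
  shows "\<exists>f. inverse_ambiguous (elliptic_curve a b) f"
proof -
  \<comment> \<open>An arbitrary linear order on the finite field, used to break the symmetry
    between \<open>x\<close> and \<open>t x\<close>.\<close>
  obtain h :: "'a \<Rightarrow> nat" where h: "inj h"
    using finite_imp_inj_to_nat_seg[of "UNIV :: 'a set"] by auto
  have "\<forall>x. \<exists>y. x \<in> S \<longrightarrow> y \<noteq> 0 \<and> y\<^sup>2 = x ^ 3 + a * x + b"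
    by (auto simp: S_def)
  then obtain s where s: "\<And>x. x \<in> S \<Longrightarrow> s x \<noteq> 0 \<and> (s x)\<^sup>2 = x ^ 3 + a * x + b"
    by metis
  \<comment> \<open>If \<open>h x < h (t x)\<close>, the cycle is (x, s x) -> (t x, s (t x)) -> (x,
    - s x) -> (t x, - s (t x)) -> (x, s x): the sign relative to \<open>s\<close> changes only on
    the way from the larger abscissa to the smaller. Points with \<open>y = 0\<close> are their own
    negatives and stay fixed.\<close>
  define f where "f P = (case P of Infinity \<Rightarrow> Infinity | Point x y \<Rightarrow>
      if y = 0 then P
      else Point (t x) (if (h x < h (t x)) = (y = s x) then s (t x) else - s (t x)))" for P
  \<comment> \<open>This lets the test \<open>y = s x\<close> tell the two points above
    \<open>x\<close> apart.\<close>
  have neg_neq: "- s x \<noteq> s x" if "x \<in> S" for x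
  proof
    assume "- s x = s x"
    then have "2 * s x = 0" by (metis mult_2 add.left_inverse)
    then show False using two s[OF that] by simp
  qed
  have less_iff: "h (t x) < h (t (t x)) \<longleftrightarrow> \<not> h x < h (t x)" if "x \<in> S" for x
    using t_t[OF that] t_neq[OF that] injD[OF h, of "t x" x] by (auto simp: not_less le_less)
  have root: "y = s x \<or> y = - s x" "x \<in> S" if "y \<noteq> 0" "y\<^sup>2 = x ^ 3 + a * x + b" for x y
  proof -
    show "x \<in> S" using that by (auto simp: S_def)
    then show "y = s x \<or> y = - s x" using that s by (metis power2_eq_iff)
  qed
  have "inverse_ambiguous (elliptic_curve a b) f"
  proof (rule inverse_ambiguousI)
    fix P assume P: "P \<in> carrier (elliptic_curve a b)"
    show "f P \<in> carrier (elliptic_curve a b)"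
    proof (cases P)
      case (Point x y)
      then show ?thesis
        using P root[of y x] t_closed[of x] s[of "t x"]
        by (auto simp: f_def point_in_elliptic_curve_iff)
    qed (use P in \<open>simp add: f_def\<close>)
    show "f (f P) = inv\<^bsub>elliptic_curve a b\<^esub> P"
    proof (cases P)
      case (Point x y)
      show ?thesis
      proof (cases "y = 0")
        case False
        have x: "x \<in> S" and y: "y = s x \<or> y = - s x"
          using root[OF False, of x] P Point by (auto simp: point_in_elliptic_curve_iff)
        have "f (f P) = Point x (- y)"
          using y s[OF x] s[OF t_closed[OF x]] neg_neq[OF x] neg_neq[OF t_closed[OF x]]
            less_iff[OF x] t_t[OF x]
          by (cases "h x < h (t x)") (auto simp: f_def Point)
        then show ?thesis
          using P Point by (simp add: inv_elliptic_curve_Point)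
      qed (use P Point in \<open>simp add: f_def inv_elliptic_curve_Point\<close>)
    qed (simp add: f_def inv_elliptic_curve_Infinity)
    show "inv\<^bsub>elliptic_curve a b\<^esub> P \<in> carrier (elliptic_curve a b)"
      using P by (cases P)
        (simp_all add: inv_elliptic_curve_Infinity inv_elliptic_curve_Point point_in_elliptic_curve_iff)
    show "inv\<^bsub>elliptic_curve a b\<^esub> (inv\<^bsub>elliptic_curve a b\<^esub> P) = P"
      using P by (cases P)
        (simp_all add: inv_elliptic_curve_Infinity inv_elliptic_curve_Point point_in_elliptic_curve_iff)
  qed
  then show ?thesis by blast
qed

text \<open>Differences of the root equations, divided by differences of the roots, yield Vieta's
  relations; the roots sum to zero because the cubic has no quadratic term.\<close>

lemma depressed_cubic_factorization:
  fixes a b :: "'a::field"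
  assumes "e ^ 3 + a * e + b = 0" "e' ^ 3 + a * e' + b = 0" "e'' ^ 3 + a * e'' + b = 0"
    and "e \<noteq> e'" "e \<noteq> e''" "e' \<noteq> e''"
  shows "x ^ 3 + a * x + b = (x - e) * (x - e') * (x - e'')"
proof -
  have "(e - e') * (e\<^sup>2 + e * e' + e'\<^sup>2 + a) = 0"
    using assms(1,2) by algebra
  then have 1: "e\<^sup>2 + e * e' + e'\<^sup>2 + a = 0"
    using assms by simp
  have "(e - e'') * (e\<^sup>2 + e * e'' + e''\<^sup>2 + a) = 0"
    using assms(1,3) by algebra
  then have 2: "e\<^sup>2 + e * e'' + e''\<^sup>2 + a = 0"
    using assms by simp
  have "(e' - e'') * (e + e' + e'') = 0"
    using 1 2 by algebra
  then have "e + e' + e'' = 0"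
    using assms by simp
  then show ?thesis
    using 1 assms(1) by algebra
qed

lemma matching_of_three_roots:
  fixes g :: "'a::field \<Rightarrow> 'a"
  assumes two: "(2::'a) \<noteq> 0"
    and g: "\<And>x. g x = (x - e) * (x - e + u) * (x - e + v)"
    and uv: "u \<noteq> 0" "v \<noteq> 0" "u \<noteq> v"
    and S_def: "S = {x. \<exists>y. y \<noteq> 0 \<and> y\<^sup>2 = g x}"
  obtains t where "\<And>x. x \<in> S \<Longrightarrow> t x \<in> S" "\<And>x. x \<in> S \<Longrightarrow> t (t x) = x" "\<And>x. x \<in> S \<Longrightarrow> t x \<noteq> x"
proof
  \<comment> \<open>For z = x - e nonzero, \<open>t\<close> preserves the branch: z and - z have the
    same square, and c = u v / z with c^2 = u v = c z would give c = z.\<close>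
  define t where "t x = (if (x - e)\<^sup>2 = u * v then 2 * e - x else e + u * v / (x - e))" for x
  fix x assume "x \<in> S"
  then obtain y where y: "y \<noteq> 0" "y\<^sup>2 = g x"
    by (auto simp: S_def)
  define z where "z = x - e"
  have x: "x = e + z"
    by (simp add: z_def)
  have y2: "y\<^sup>2 = z * (z + u) * (z + v)"
    using y g by (simp add: z_def)
  then have z: "z \<noteq> 0"
    using y by auto
  have "t x \<in> S \<and> t (t x) = x \<and> t x \<noteq> x"
  proof (cases "z\<^sup>2 = u * v")
    case True
    then have t: "t x = e - z" "t (e - z) = x"
      by (simp_all add: t_def x)
    \<comment> \<open>The product g (e + z) g (e - z) is the square of z^2 (u - v), so dividing by
      the root y of g (e + z) leaves a root of g (e - z).\<close>
    define w where "w = z\<^sup>2 * (u - v) / y"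
    have w: "w * y = z\<^sup>2 * (u - v)"
      using y by (simp add: w_def)
    have "y\<^sup>2 * (w\<^sup>2 - g (e - z)) = 0"
      using w y2 True g[of "e - z"] by algebra
    then have "w\<^sup>2 = g (e - z)"
      using y(1) by simp
    moreover have "w \<noteq> 0"
      using y z uv by (simp add: w_def)
    ultimately have "e - z \<in> S"
      by (auto simp: S_def)
    moreover have "e - z \<noteq> x"
    proof
      assume "e - z = x"
      then have "2 * z = 0" unfolding x by algebra
      then show False using z two by simp
    qed
    ultimately show ?thesis
      using t by simp
  next
    case False
    define c where "c = u * v / z"
    have c: "c * z = u * v"
      using z by (simp add: c_def)
    have "c \<noteq> 0"
      using z uv by (simp add: c_def)
    have "c \<noteq> z"
      using c False by (auto simp: power2_eq_square)
    have "c\<^sup>2 \<noteq> u * v"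
      using c \<open>c \<noteq> z\<close> \<open>c \<noteq> 0\<close> by (metis mult_left_cancel power2_eq_square)
    then have t: "t x = e + c" "t (e + c) = x"
      using False \<open>c \<noteq> 0\<close> by (simp_all add: t_def x c_def uv)
    \<comment> \<open>Up to sign, the ordinate of (x, y) + (e, 0): the chord has slope y /
      z.\<close>
    define w where "w = c * y / z"
    have w: "w * z = c * y"
      using z by (simp add: w_def)
    have "z ^ 2 * (w\<^sup>2 - g (e + c)) = 0"
      using w c y2 g[of "e + c"] by algebra
    then have "w\<^sup>2 = g (e + c)"
      using z by simp
    moreover have "w \<noteq> 0"
      using y z \<open>c \<noteq> 0\<close> by (simp add: w_def)
    ultimately have "e + c \<in> S"
      by (auto simp: S_def)
    then show ?thesis
      using t \<open>c \<noteq> z\<close> x by simp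
  qed
  then show "t x \<in> S" "t (t x) = x" "t x \<noteq> x"
    by auto
qed

theorem proposition3p5:
  fixes a b :: int
  assumes "of_int (- 16 * (4 * a ^ 3 + 27 * b\<^sup>2)) \<noteq> (0 :: 'a :: {field, finite})"
    and "card {x :: 'a. poly (weierstrass_poly (of_int a) (of_int b)) x = 0} = 3"
  shows "\<exists>f. inverse_ambiguous (elliptic_curve (of_int a :: 'a) (of_int b)) f \<and>
    continuous_map
      (discrete_topology (carrier (elliptic_curve (of_int a :: 'a) (of_int b))))
      (discrete_topology (carrier (elliptic_curve (of_int a :: 'a) (of_int b)))) f"
proof -
  define A B :: 'a where "A = of_int a" and "B = of_int b"
  \<comment> \<open>The factor 16 of the discriminant excludes characteristic 2.\<close>
  have two: "(2::'a) \<noteq> 0"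
  proof
    assume "(2::'a) = 0"
    moreover have "of_int (- 16 * (4 * a ^ 3 + 27 * b\<^sup>2)) =
        (2::'a) * of_int (- 8 * (4 * a ^ 3 + 27 * b\<^sup>2))"
      by (simp add: algebra_simps)
    ultimately show False
      using assms(1) by simp
  qed
  obtain e e' e'' where roots: "{x. poly (weierstrass_poly A B) x = 0} = {e, e', e''}"
    and distinct: "e \<noteq> e'" "e \<noteq> e''" "e' \<noteq> e''"
    using assms(2) unfolding card_3_iff A_def B_def by auto
  have root: "x ^ 3 + A * x + B = 0" if "x \<in> {e, e', e''}" for x
    using that unfolding roots[symmetric]
    by (simp add: weierstrass_poly_def algebra_simps power3_eq_cube)
  \<comment> \<open>Here u = e - e' and v = e - e'', so distinct roots make u and v nonzero and
    different.\<close>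
  have cubic: "x ^ 3 + A * x + B = (x - e) * (x - e + (e - e')) * (x - e + (e - e''))" for x
    using depressed_cubic_factorization[of e A B e' e'' x] root distinct by simp
  define S where "S = {x. \<exists>y. y \<noteq> 0 \<and> y\<^sup>2 = x ^ 3 + A * x + B}"
  obtain t where "\<And>x. x \<in> S \<Longrightarrow> t x \<in> S" "\<And>x. x \<in> S \<Longrightarrow> t (t x) = x" "\<And>x. x \<in> S \<Longrightarrow> t x \<noteq> x"
    using matching_of_three_roots[OF two cubic _ _ _ S_def] distinct by auto
  then obtain f where f: "inverse_ambiguous (elliptic_curve A B) f"
    using inverse_ambiguous_elliptic_curve_if_matching[OF two S_def] by blast
  then have "f ` carrier (elliptic_curve A B) = carrier (elliptic_curve A B)"
    by (simp add: inverse_ambiguous_def bij_betw_def)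
  then have "f \<in> carrier (elliptic_curve A B) \<rightarrow> carrier (elliptic_curve A B)"
    by blast
  then show ?thesis
    using f unfolding A_def B_def by auto
qed

end
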